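(* Let $E$ be a Banach space, let $T>0$ and let $x,e\in E$ be fixed. Let $P^x$ and $P_T$ be the path law and the Markov operator described in the context. (1) Let $(X,Y)$ be a coupling by change of measure for $P^x$ and $P^x$ with changed probability $\mathbf Q=R\,\mathbf P$ such that $Y(T)=X(T)+e$. Then for every $p>1$ the shift Harnack inequality $$|P_Tf(x)|^p\le P_T\{|f|^p(e+\cdot)\}(x)\,\bigl(\mathbf E R^{p/(p-1)}\bigr)^{p-1},\qquad f\in\mathcal B_b(E),$$ holds, and the shift log-Harnack inequality $$P_T\log f(x)\le \log P_T\{f(e+\cdot)\}(x)+\mathbf E(R\log R),\qquad f\in\mathcal B_b(E),\ f>0,$$ holds. (2) Let $(X,X^\varepsilon)$, $\varepsilon\in[0,1]$, be a family of couplings by change of measure for $P^x$ and $P^x$ with changed probabilities $\mathbf Q_\varepsilon=R_\varepsilon\mathbf P$ such that $$X^\varepsilon(T)=X(T)+\varepsilon e,\qquad \varepsilon\in(0,1].$$ If $R_0=1$ and $N(T):=-\frac{\mathrm d}{\mathrm d\varepsilon}R_\varepsilon\big|_{\varepsilon=0}$ exists in $L^1(\mathbf P)$, then $$P_T(\nabla_e f)(x)=\mathbf E\{f(X(T))N(T)\}\qquad\text{for all } f \text{ with } f,\nabla_e f\in\mathcal B_b(E).$$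
   Context: $E$ carries its Borel $\sigma$-field $\mathcal B$; $\mathcal B_b(E)$ is the set of bounded measurable real functions on $E$. The path space $E^{[0,T]}$ carries the product $\sigma$-field $\mathcal B^{[0,T]}$. $\{P^x(A): x\in E, A\in\mathcal B^{[0,T]}\}$ is a transition probability (a probability kernel from $E$ to $E^{[0,T]}$) with $P^x(\{\gamma:\gamma(0)=x\})=1$ for all $x\in E$. For $t\in[0,T]$, $P_t(x,\cdot)=P^x(\{\gamma:\gamma(t)\in\cdot\})$ and $P_tf(x)=\int_E f(y)P_t(x,\mathrm dy)$, $f\in\mathcal B_b(E)$ (the same formula being used for other measurable $f$ for which the integral makes sense). The function $f(e+\cdot)$ is $y\mapsto f(e+y)$, and $\{|f|^p(e+\cdot)\}(y)=|f(e+y)|^p$. $\nabla_e f(y)=\lim_{\varepsilon\to0}\frac{f(y+\varepsilon e)-f(y)}{\varepsilon}$ is the directional derivative. Coupling by change of measure: let $\mu,\nu$ be probability measures on a measurable space and let $X,Y$ be random variables with values in that space, defined on a probability space $(\Omega,\mathcal F,\mathbf P)$. If $X$ has distribution $\mu$ under $\mathbf P$, while $Y$ has distribution $\nu$ under another probability measure $\mathbf Q$ on $(\Omega,\mathcal F)$, then $(X,Y)$ is called a coupling by change of measure for $\mu$ and $\nu$ with changed probability $\mathbf Q$. Here $X,Y,X^\varepsilon$ are $E^{[0,T]}$-valued (i.e. processes on $[0,T]$), $R$ and $R_\varepsilon$ are the probability densities of $\mathbf Q$, $\mathbf Q_\varepsilon$ with respect to $\mathbf P$, and $\mathbf E$ is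 expectation under $\mathbf P$. In part (2) all couplings live on the same $(\Omega,\mathcal F,\mathbf P)$ with the same $X$, and existence of the derivative in $L^1(\mathbf P)$ means that $(R_\varepsilon-R_0)/\varepsilon$ converges in $L^1(\mathbf P)$ as $\varepsilon\downarrow0$. *)

theory Defs
  imports "HOL-Probability.Probability"
begin

text \<open>As always for \<^const>\<open>PiM\<close>, the paths are the
  functions on \<^typ>\<open>real\<close> that equal \<^const>\<open>undefined\<close> outside \<^term>\<open>{0..T}\<close>.\<close>

definition path_space :: "real \<Rightarrow> (real \<Rightarrow> 'a::topological_space) measure" where
  "path_space T = PiM {0..T} (\<lambda>_. borel)"

definition path_kernel :: "real \<Rightarrow> ('a::banach \<Rightarrow> (real \<Rightarrow> 'a) measure) \<Rightarrow> bool" where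
  "path_kernel T P \<longleftrightarrow>
     P \<in> borel \<rightarrow>\<^sub>M prob_algebra (path_space T) \<and>
     (\<forall>x. measure (P x) {\<gamma> \<in> space (path_space T). \<gamma> 0 = x} = 1)"

definition trans_prob :: "('a::banach \<Rightarrow> (real \<Rightarrow> 'a) measure) \<Rightarrow> real \<Rightarrow> 'a \<Rightarrow> 'a measure" where
  "trans_prob P t x = distr (P x) borel (\<lambda>\<gamma>. \<gamma> t)"

definition markov_op ::
    "('a::banach \<Rightarrow> (real \<Rightarrow> 'a) measure) \<Rightarrow> real \<Rightarrow> ('a \<Rightarrow> real) \<Rightarrow> 'a \<Rightarrow> real" where
  "markov_op P t f x = (\<integral>y. f y \<partial>trans_prob P t x)"

text \<open>Integral with values in the extended reals, meaningful as soon as the positive or the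
  negative part of \<open>f\<close> has finite integral. It is needed because \<open>log f\<close> is only bounded above
  and \<open>R log R\<close> only bounded below.\<close>

definition ext_integral :: "'b measure \<Rightarrow> ('b \<Rightarrow> real) \<Rightarrow> ereal" where
  "ext_integral M f =
     enn2ereal (\<integral>\<^sup>+y. ennreal (f y) \<partial>M) - enn2ereal (\<integral>\<^sup>+y. ennreal (- f y) \<partial>M)"

lemma ext_integral_eq_integral:
  assumes "integrable M f"
  shows "ext_integral M f = ereal (\<integral>y. f y \<partial>M)"
proof -
  have "(\<integral>\<^sup>+y. ennreal (f y) \<partial>M) \<noteq> \<infinity>" "(\<integral>\<^sup>+y. ennreal (- f y) \<partial>M) \<noteq> \<infinity>"
    using assms by (auto simp: real_integrable_def)
  then show ?thesis
    unfolding ext_integral_def real_lebesgue_integral_def[OF assms]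
    by (cases "\<integral>\<^sup>+y. ennreal (f y) \<partial>M"; cases "\<integral>\<^sup>+y. ennreal (- f y) \<partial>M")
       (auto simp: enn2ereal_ennreal)
qed

definition markov_op_ext ::
    "('a::banach \<Rightarrow> (real \<Rightarrow> 'a) measure) \<Rightarrow> real \<Rightarrow> ('a \<Rightarrow> real) \<Rightarrow> 'a \<Rightarrow> ereal" where
  "markov_op_ext P t f x = ext_integral (trans_prob P t x) f"

text \<open>Real power of an extended nonnegative number, for exponents \<open>a > 0\<close>.\<close>

definition enn_powr :: "ennreal \<Rightarrow> real \<Rightarrow> ennreal" where
  "enn_powr z a = (if z = \<infinity> then \<infinity> else ennreal (enn2real z powr a))"

definition bdd_measurable :: "('a::topological_space \<Rightarrow> real) set" where
  "bdd_measurable = {f \<in> borel_measurable borel. bounded (range f)}"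

definition has_dir_deriv :: "'a::real_normed_vector \<Rightarrow> ('a \<Rightarrow> real) \<Rightarrow> 'a \<Rightarrow> real \<Rightarrow> bool" where
  "has_dir_deriv e f y d \<longleftrightarrow> ((\<lambda>\<epsilon>. (f (y + \<epsilon> *\<^sub>R e) - f y) / \<epsilon>) \<longlongrightarrow> d) (at 0)"

text \<open>The value is arbitrary where the limit does not exist, so existence has to be required
  separately.\<close>

definition dir_deriv :: "'a::real_normed_vector \<Rightarrow> ('a \<Rightarrow> real) \<Rightarrow> 'a \<Rightarrow> real" where
  "dir_deriv e f y = Lim (at 0) (\<lambda>\<epsilon>. (f (y + \<epsilon> *\<^sub>R e) - f y) / \<epsilon>)"

definition coupling_by_change_of_measure ::
    "'w measure \<Rightarrow> 'w measure \<Rightarrow> 's measure \<Rightarrow> 's measure \<Rightarrow> ('w \<Rightarrow> 's) \<Rightarrow> ('w \<Rightarrow> 's) \<Rightarrow> bool" where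
  "coupling_by_change_of_measure M Q \<mu> \<nu> X Y \<longleftrightarrow>
     prob_space M \<and> prob_space Q \<and> sets Q = sets M \<and>
     prob_space \<mu> \<and> prob_space \<nu> \<and> sets \<nu> = sets \<mu> \<and>
     X \<in> M \<rightarrow>\<^sub>M \<mu> \<and> Y \<in> M \<rightarrow>\<^sub>M \<nu> \<and>
     distr M \<mu> X = \<mu> \<and> distr Q \<nu> Y = \<nu>"

definition has_density :: "'w measure \<Rightarrow> 'w measure \<Rightarrow> ('w \<Rightarrow> real) \<Rightarrow> bool" where
  "has_density M Q R \<longleftrightarrow>
     R \<in> borel_measurable M \<and> (AE \<omega> in M. 0 \<le> R \<omega>) \<and> Q = density M (\<lambda>\<omega>. ennreal (R \<omega>))"

text \<open>\<open>D\<close> is the right derivative at \<open>0\<close> of the family \<open>R\<close> in the sense of \<open>L\<^sup>1(M)\<close>.\<close>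

definition has_L1_right_deriv_at_0 ::
    "'w measure \<Rightarrow> (real \<Rightarrow> 'w \<Rightarrow> real) \<Rightarrow> ('w \<Rightarrow> real) \<Rightarrow> bool" where
  "has_L1_right_deriv_at_0 M R D \<longleftrightarrow>
     integrable M D \<and>
     ((\<lambda>\<epsilon>. \<integral>\<^sup>+\<omega>. ennreal \<bar>(R \<epsilon> \<omega> - R 0 \<omega>) / \<epsilon> - D \<omega>\<bar> \<partial>M) \<longlongrightarrow> 0) (at_right 0)"

end

theory Submission
  imports Defs
begin

text \<open>
  Everything rests on writing the same number \<open>P\<^sub>T h(x)\<close> in two ways. Since \<open>X\<close> has law \<open>P\<^sup>x\<close> under
  \<open>M\<close> and \<open>Y\<close> has law \<open>P\<^sup>x\<close> under \<open>Q = R M\<close>, where \<open>Y(T) = X(T) + e\<close>,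
  \<open>P\<^sub>T h(x) = E(h(X(T))) = E(R h(X(T) + e))\<close>.
  Once these two identities hold, what remains are statements about the single random vector
  \<open>X(T)\<close> and the density \<open>R\<close>.

  With \<open>g = |f(X(T) + e)|\<close>, the shift Harnack inequality is the Hoelder inequality for \<open>E(R g)\<close>
  with exponents \<open>p/(p-1)\<close> and \<open>p\<close>, raised to the power \<open>p\<close> (\<open>Holder_inequality_powr\<close>). The shift
  log-Harnack inequality is the Gibbs variational inequality
  \<open>E(R ln g) \<le> ln E(g) + E(R ln R)\<close> for \<open>g = f(X(T) + e)\<close> (\<open>entropy_inequality\<close>), which comes from
  integrating \<open>ln t \<le> t - 1\<close>.

  For the integration by parts formula, the two expressions for \<open>P\<^sub>T f(x)\<close> are compared for the
  shift by \<open>\<epsilon> e\<close>: their difference vanishes, and dividing by \<open>\<epsilon>\<close> gives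
  \<open>E((f(X(T) + \<epsilon> e) - f(X(T))) / \<epsilon>) = - E((R\<^sub>\<epsilon> - 1) / \<epsilon> * f(X(T) + \<epsilon> e))\<close>.
  On the left, the mean value theorem along the line through \<open>X(T)\<close> in direction \<open>e\<close> bounds the
  quotients by the supremum of \<open>|\<nabla>\<^sub>e f|\<close>, so dominated convergence gives \<open>P\<^sub>T(\<nabla>\<^sub>e f)(x)\<close>. On the right,
  an \<open>L\<^sup>1\<close>-convergent factor, with limit \<open>-N\<close>, meets a bounded factor that converges pointwise by
  continuity of \<open>f\<close> along the line (\<open>tendsto_integral_L1_mult_bounded\<close>), and the limit is
  \<open>E(f(X(T)) N)\<close>.
\<close>

section \<open>Extended integrals\<close>

lemma ext_integral_distr:
  assumes "X \<in> measurable M N" "h \<in> borel_measurable N"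
  shows "ext_integral (distr M N X) h = ext_integral M (\<lambda>\<omega>. h (X \<omega>))"
  using assms by (simp add: ext_integral_def nn_integral_distr)

lemma ext_integral_density:
  assumes [measurable]: "h \<in> borel_measurable M" "R \<in> borel_measurable M"
    and R: "AE \<omega> in M. 0 \<le> R \<omega>"
  shows "ext_integral (density M (\<lambda>\<omega>. ennreal (R \<omega>))) h = ext_integral M (\<lambda>\<omega>. R \<omega> * h \<omega>)"
proof -
  have "(\<integral>\<^sup>+\<omega>. ennreal (k \<omega>) \<partial>density M (\<lambda>\<omega>. ennreal (R \<omega>))) = (\<integral>\<^sup>+\<omega>. ennreal (R \<omega> * k \<omega>) \<partial>M)"
    if [measurable]: "k \<in> borel_measurable M" for k :: "'a \<Rightarrow> real"
    using R by (auto simp: nn_integral_density ennreal_mult' intro!: nn_integral_cong_AE)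
  from this[of h] this[of "\<lambda>\<omega>. - h \<omega>"] show ?thesis
    by (simp add: ext_integral_def)
qed

text \<open>In \<^typ>\<open>ereal\<close>, where \<open>\<infinity> - \<infinity> = \<infinity>\<close>, subtraction is monotone in its first and antitone in
  its second argument without exception, so the comparison of positive and negative parts carries
  over to their difference even when both are infinite.\<close>

lemma ext_integral_mono_AE:
  assumes "AE \<omega> in M. u \<omega> \<le> v \<omega>"
  shows "ext_integral M u \<le> ext_integral M v"
  unfolding ext_integral_def
proof (rule ereal_minus_mono)
  show "enn2ereal (\<integral>\<^sup>+y. ennreal (u y) \<partial>M) \<le> enn2ereal (\<integral>\<^sup>+y. ennreal (v y) \<partial>M)"
    unfolding less_eq_ennreal.rep_eq[symmetric]
    using assms by (intro nn_integral_mono_AE) (auto intro: ennreal_leI)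
  show "enn2ereal (\<integral>\<^sup>+y. ennreal (- v y) \<partial>M) \<le> enn2ereal (\<integral>\<^sup>+y. ennreal (- u y) \<partial>M)"
    unfolding less_eq_ennreal.rep_eq[symmetric]
    using assms by (intro nn_integral_mono_AE) (auto elim!: eventually_mono intro: ennreal_leI)
qed

lemma ext_integral_infty:
  assumes "u \<in> borel_measurable M" "\<not> integrable M u" "(\<integral>\<^sup>+\<omega>. ennreal (- u \<omega>) \<partial>M) < \<infinity>"
  shows "ext_integral M u = \<infinity>"
proof -
  have "(\<integral>\<^sup>+\<omega>. ennreal (u \<omega>) \<partial>M) = \<infinity>"
    using assms by (auto simp: real_integrable_def)
  then show ?thesis
    by (simp add: ext_integral_def)
qed

section \<open>The Hoelder and the entropy inequality\<close>

text \<open>After normalising \<open>g\<close> by \<open>b = (\<integral> g\<^sup>p)\<^bsup>1/p\<^esup>\<close> and \<open>R\<close> by \<open>a = (\<integral> R\<^sup>q)\<^bsup>1/q\<^esup>\<close>, Young's inequality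
  holds pointwise and integrates to \<open>1/p + 1/q = 1\<close>. If \<open>a\<close> or \<open>b\<close> vanishes, so does \<open>R g\<close> almost
  everywhere; this covers the product \<open>0 * \<infinity> = 0\<close> on the right-hand side. The integral of
  \<open>R\<^sup>q\<close> is allowed to be infinite, which is why the bound is stated in \<^typ>\<open>ennreal\<close>.\<close>

lemma Holder_inequality_powr:
  fixes R g :: "'w \<Rightarrow> real"
  assumes [measurable]: "R \<in> borel_measurable M" "g \<in> borel_measurable M"
    and p: "p > 1"
    and R: "AE \<omega> in M. 0 \<le> R \<omega>" and g: "\<And>\<omega>. 0 \<le> g \<omega>"
    and Rg: "integrable M (\<lambda>\<omega>. R \<omega> * g \<omega>)" and gp: "integrable M (\<lambda>\<omega>. g \<omega> powr p)"
  shows "ennreal ((\<integral>\<omega>. R \<omega> * g \<omega> \<partial>M) powr p)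
    \<le> ennreal (\<integral>\<omega>. g \<omega> powr p \<partial>M)
        * enn_powr (\<integral>\<^sup>+\<omega>. ennreal (R \<omega> powr (p / (p - 1))) \<partial>M) (p - 1)"
proof -
  define q where "q = p / (p - 1)"
  define A where "A = (\<integral>\<omega>. R \<omega> powr q \<partial>M)"
  define B where "B = (\<integral>\<omega>. g \<omega> powr p \<partial>M)"
  have q: "q > 1" "1 / p + 1 / q = 1" "p / q = p - 1"
    using p by (auto simp: q_def field_simps)
  have nn: "0 \<le> A" "0 \<le> B" by (auto simp: A_def B_def)
  have zero: ?thesis if "AE \<omega> in M. R \<omega> * g \<omega> = 0"
  proof -
    have "(\<integral>\<omega>. R \<omega> * g \<omega> \<partial>M) = 0"
      using that by (rule integral_eq_zero_AE)
    then show ?thesis using p by simp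
  qed
  show ?thesis
  proof (cases "B = 0")
    case True
    then have "AE \<omega> in M. g \<omega> powr p = 0"
      using gp unfolding B_def by (subst (asm) integral_nonneg_eq_0_iff_AE) auto
    then show ?thesis by (intro zero) auto
  next
    case B0: False
    with nn have B: "B > 0" by simp
    show ?thesis
    proof (cases "integrable M (\<lambda>\<omega>. R \<omega> powr q)")
      case False
      then have "(\<integral>\<^sup>+\<omega>. ennreal (R \<omega> powr q) \<partial>M) = \<infinity>"
        by (subst (asm) integrable_iff_bounded) (auto simp: less_top[symmetric])
      then show ?thesis
        using B by (simp add: enn_powr_def B_def q_def ennreal_mult_top)
    next
      case Rq: True
      show ?thesis
      proof (cases "A = 0")
        case True
        then have "AE \<omega> in M. R \<omega> powr q = 0"
          using Rq unfolding A_def by (subst (asm) integral_nonneg_eq_0_iff_AE) auto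
        then show ?thesis by (intro zero) auto
      next
        case False
        with nn have A: "A > 0" by simp
        define a b where "a = A powr (1 / q)" and "b = B powr (1 / p)"
        have ab: "a > 0" "b > 0" "a powr q = A" "b powr p = B"
          using A B p q by (auto simp: a_def b_def powr_powr)
        have "(\<integral>\<omega>. R \<omega> * g \<omega> / (a * b) \<partial>M)
          \<le> (\<integral>\<omega>. g \<omega> powr p / (B * p) + R \<omega> powr q / (A * q) \<partial>M)"
        proof (rule integral_mono_AE)
          show "AE \<omega> in M. R \<omega> * g \<omega> / (a * b) \<le> g \<omega> powr p / (B * p) + R \<omega> powr q / (A * q)"
            using R
          proof eventually_elim
            case (elim \<omega>)
            then show ?case
              using Youngs_inequality[of p q "g \<omega> / b" "R \<omega> / a"] p q ab g[of \<omega>]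
              by (simp add: powr_divide mult.commute)
          qed
        qed (use Rg gp Rq in auto)
        also have "\<dots> = B / (B * p) + A / (A * q)"
          using gp Rq by (simp add: A_def B_def)
        also have "\<dots> = 1"
          using A B q by simp
        finally have "(\<integral>\<omega>. R \<omega> * g \<omega> \<partial>M) \<le> a * b"
          using ab by (simp add: field_simps)
        moreover have "0 \<le> (\<integral>\<omega>. R \<omega> * g \<omega> \<partial>M)"
          using R g by (intro integral_nonneg_AE) auto
        ultimately have "(\<integral>\<omega>. R \<omega> * g \<omega> \<partial>M) powr p \<le> (a * b) powr p"
          using p by (intro powr_mono2) auto
        also have "\<dots> = B * A powr (p - 1)"
          using ab p q A by (simp add: powr_mult a_def powr_powr)
        finally have le: "(\<integral>\<omega>. R \<omega> * g \<omega> \<partial>M) powr p \<le> B * A powr (p - 1)" .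
        have "(\<integral>\<^sup>+\<omega>. ennreal (R \<omega> powr q) \<partial>M) = ennreal A"
          unfolding A_def using Rq by (intro nn_integral_eq_integral) auto
        then have "enn_powr (\<integral>\<^sup>+\<omega>. ennreal (R \<omega> powr q) \<partial>M) (p - 1) = ennreal (A powr (p - 1))"
          using A by (simp add: enn_powr_def)
        then show ?thesis
          using ennreal_leI[OF le] B by (simp add: q_def B_def ennreal_mult')
      qed
    qed
  qed
qed

text \<open>Where \<open>R > 0\<close>, the inequality \<open>ln t \<le> t - 1\<close> at \<open>t = g / (G R)\<close> with \<open>G = \<integral> g\<close>, multiplied by
  \<open>R\<close>, reads \<open>R ln g \<le> R ln R + (R ln G - R + g / G)\<close>; where \<open>R = 0\<close>, it holds since \<open>g > 0\<close>. The
  term in brackets has integral \<open>ln G\<close>. If \<open>R ln R\<close> is not integrable, the right-hand side of the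
  claim is \<open>\<infinity>\<close>, because \<open>R ln R \<ge> R - 1 \<ge> -1\<close> makes the negative part integrable. The integral
  of \<open>R ln g\<close> may be \<open>-\<infinity>\<close>.\<close>

lemma entropy_inequality:
  fixes R g :: "'w \<Rightarrow> real"
  assumes "prob_space M"
    and [measurable]: "R \<in> borel_measurable M"
    and R: "AE \<omega> in M. 0 \<le> R \<omega>" and R1: "integrable M R" "(\<integral>\<omega>. R \<omega> \<partial>M) = 1"
    and g: "integrable M g" "\<And>\<omega>. 0 < g \<omega>"
  shows "ext_integral M (\<lambda>\<omega>. R \<omega> * ln (g \<omega>))
    \<le> ereal (ln (\<integral>\<omega>. g \<omega> \<partial>M)) + ext_integral M (\<lambda>\<omega>. R \<omega> * ln (R \<omega>))"
proof (cases "integrable M (\<lambda>\<omega>. R \<omega> * ln (R \<omega>))")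
  case False
  interpret prob_space M by fact
  have "(\<integral>\<^sup>+\<omega>. ennreal (- (R \<omega> * ln (R \<omega>))) \<partial>M) \<le> (\<integral>\<^sup>+\<omega>. 1 \<partial>M)"
    using R
  proof (intro nn_integral_mono_AE, eventually_elim)
    case (elim \<omega>)
    show ?case
    proof (cases "R \<omega> = 0")
      case False
      with elim have "R \<omega> > 0" by simp
      with ln_le_minus_one[of "inverse (R \<omega>)"] have "R \<omega> * - ln (R \<omega>) \<le> R \<omega> * (inverse (R \<omega>) - 1)"
        by (intro mult_left_mono) (auto simp: ln_inverse)
      also have "\<dots> \<le> 1"
        using \<open>R \<omega> > 0\<close> by (simp add: field_simps)
      finally have "- (R \<omega> * ln (R \<omega>)) \<le> 1" by simp
      from ennreal_leI[OF this] show ?thesis by simp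
    qed simp
  qed
  also have "\<dots> < \<infinity>" by (simp add: emeasure_space_1)
  finally have "ext_integral M (\<lambda>\<omega>. R \<omega> * ln (R \<omega>)) = \<infinity>"
    using False by (intro ext_integral_infty) auto
  then show ?thesis by simp
next
  case u: True
  interpret prob_space M by fact
  define G where "G = (\<integral>\<omega>. g \<omega> \<partial>M)"
  have "G \<noteq> 0"
  proof
    assume "G = 0"
    then have "AE \<omega> in M. g \<omega> = 0"
      using g unfolding G_def
      by (subst (asm) integral_nonneg_eq_0_iff_AE) (auto intro: less_imp_le)
    then have "AE \<omega> in M. False"
      by eventually_elim (use g(2) in \<open>simp add: less_le\<close>)
    then show False by simp
  qed
  moreover have "G \<ge> 0"
    unfolding G_def using g(2) by (intro integral_nonneg_AE) (auto intro: less_imp_le)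
  ultimately have G: "G > 0" by simp
  define v where "v \<omega> = R \<omega> * ln G - R \<omega> + g \<omega> / G" for \<omega>
  have v: "integrable M v" "(\<integral>\<omega>. v \<omega> \<partial>M) = ln G"
    using R1 g(1) G by (auto simp: v_def[abs_def] G_def)
  have "ext_integral M (\<lambda>\<omega>. R \<omega> * ln (g \<omega>)) \<le> ext_integral M (\<lambda>\<omega>. R \<omega> * ln (R \<omega>) + v \<omega>)"
    using R
  proof (intro ext_integral_mono_AE, eventually_elim)
    case (elim \<omega>)
    show ?case
    proof (cases "R \<omega> = 0")
      case True
      then show ?thesis using G g(2)[of \<omega>] by (simp add: v_def)
    next
      case False
      with elim have r: "R \<omega> > 0" by simp
      have "ln (g \<omega> / (G * R \<omega>)) \<le> g \<omega> / (G * R \<omega>) - 1"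
        using r G g(2)[of \<omega>] by (intro ln_le_minus_one) auto
      then have "R \<omega> * (ln (g \<omega>) - ln G - ln (R \<omega>)) \<le> R \<omega> * (g \<omega> / (G * R \<omega>) - 1)"
        using r G g(2)[of \<omega>] by (intro mult_left_mono) (auto simp: ln_div ln_mult)
      also have "\<dots> = g \<omega> / G - R \<omega>"
        using r G by (simp add: field_simps)
      finally show ?thesis
        by (simp add: v_def algebra_simps)
    qed
  qed
  also have "\<dots> = ereal (\<integral>\<omega>. R \<omega> * ln (R \<omega>) + v \<omega> \<partial>M)"
    using u v by (intro ext_integral_eq_integral) auto
  also have "(\<integral>\<omega>. R \<omega> * ln (R \<omega>) + v \<omega> \<partial>M) = ln G + (\<integral>\<omega>. R \<omega> * ln (R \<omega>) \<partial>M)"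
    using u v by simp
  finally show ?thesis
    using ext_integral_eq_integral[OF u] by (simp add: G_def)
qed

section \<open>Products of an L1-convergent and a boundedly convergent sequence\<close>

text \<open>Split \<open>D\<^sub>n h\<^sub>n - D' h' = (D\<^sub>n - D') h\<^sub>n + D' (h\<^sub>n - h')\<close>. The first part is at most
  \<open>C |D\<^sub>n - D'|\<close>, the second is handled by dominated convergence with majorant \<open>C |D'|\<close>.\<close>

lemma tendsto_integral_L1_mult_bounded:
  fixes D :: "nat \<Rightarrow> 'w \<Rightarrow> real"
  assumes D: "\<And>n. integrable M (D n)" and D': "integrable M D'"
    and L1: "(\<lambda>n. \<integral>\<^sup>+\<omega>. ennreal \<bar>D n \<omega> - D' \<omega>\<bar> \<partial>M) \<longlonglongrightarrow> 0"
    and [measurable]: "\<And>n. h n \<in> borel_measurable M" "h' \<in> borel_measurable M"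
    and C: "\<And>n \<omega>. \<bar>h n \<omega>\<bar> \<le> C"
    and h: "\<And>\<omega>. (\<lambda>n. h n \<omega>) \<longlonglongrightarrow> h' \<omega>"
  shows "(\<lambda>n. \<integral>\<omega>. D n \<omega> * h n \<omega> \<partial>M) \<longlonglongrightarrow> (\<integral>\<omega>. D' \<omega> * h' \<omega> \<partial>M)"
proof -
  have bdd: "integrable M (\<lambda>\<omega>. k \<omega> * h n \<omega>)" if k: "integrable M k" for k :: "'w \<Rightarrow> real" and n
  proof (rule Bochner_Integration.integrable_bound)
    show "integrable M (\<lambda>\<omega>. C * k \<omega>)" using k by simp
    show "(\<lambda>\<omega>. k \<omega> * h n \<omega>) \<in> borel_measurable M" using k by auto
    show "AE \<omega> in M. norm (k \<omega> * h n \<omega>) \<le> norm (C * k \<omega>)"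
    proof (rule AE_I2)
      fix \<omega>
      have "\<bar>h n \<omega>\<bar> \<le> \<bar>C\<bar>" using C[of n \<omega>] by linarith
      then show "norm (k \<omega> * h n \<omega>) \<le> norm (C * k \<omega>)"
        using mult_right_mono[of "\<bar>h n \<omega>\<bar>" "\<bar>C\<bar>" "\<bar>k \<omega>\<bar>"]
        by (simp add: abs_mult mult.commute)
    qed
  qed
  have "(\<lambda>n. \<integral>\<omega>. \<bar>D n \<omega> - D' \<omega>\<bar> \<partial>M) \<longlonglongrightarrow> 0"
  proof -
    have "(\<lambda>n. ennreal (\<integral>\<omega>. \<bar>D n \<omega> - D' \<omega>\<bar> \<partial>M)) \<longlonglongrightarrow> ennreal 0"
      using L1 D D' by (subst nn_integral_eq_integral[symmetric]) auto
    then show ?thesis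
      by (rule tendsto_ennrealD) auto
  qed
  then have 0: "(\<lambda>n. C * (\<integral>\<omega>. \<bar>D n \<omega> - D' \<omega>\<bar> \<partial>M)) \<longlonglongrightarrow> 0"
    by (rule tendsto_mult_right_zero)
  have "(\<lambda>n. \<integral>\<omega>. (D n \<omega> - D' \<omega>) * h n \<omega> \<partial>M) \<longlonglongrightarrow> 0"
  proof (rule Lim_null_comparison[OF _ 0], rule always_eventually, rule allI)
    fix n
    have "norm (\<integral>\<omega>. (D n \<omega> - D' \<omega>) * h n \<omega> \<partial>M)
        \<le> (\<integral>\<omega>. norm ((D n \<omega> - D' \<omega>) * h n \<omega>) \<partial>M)"
      by (rule integral_norm_bound)
    also have "\<dots> \<le> (\<integral>\<omega>. C * \<bar>D n \<omega> - D' \<omega>\<bar> \<partial>M)"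
    proof (rule integral_mono)
      show "integrable M (\<lambda>\<omega>. norm ((D n \<omega> - D' \<omega>) * h n \<omega>))"
        using D D' by (intro integrable_norm bdd) auto
      show "integrable M (\<lambda>\<omega>. C * \<bar>D n \<omega> - D' \<omega>\<bar>)" using D D' by auto
      show "norm ((D n \<omega> - D' \<omega>) * h n \<omega>) \<le> C * \<bar>D n \<omega> - D' \<omega>\<bar>" for \<omega>
        using C[of n \<omega>] by (simp add: abs_mult mult.commute mult_right_mono)
    qed
    finally show "norm (\<integral>\<omega>. (D n \<omega> - D' \<omega>) * h n \<omega> \<partial>M) \<le> C * (\<integral>\<omega>. \<bar>D n \<omega> - D' \<omega>\<bar> \<partial>M)"
      by simp
  qed
  moreover have "(\<lambda>n. \<integral>\<omega>. D' \<omega> * h n \<omega> \<partial>M) \<longlonglongrightarrow> (\<integral>\<omega>. D' \<omega> * h' \<omega> \<partial>M)"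
  proof (rule integral_dominated_convergence)
    show "integrable M (\<lambda>\<omega>. C * \<bar>D' \<omega>\<bar>)" using D' by auto
    show "AE \<omega> in M. (\<lambda>n. D' \<omega> * h n \<omega>) \<longlonglongrightarrow> D' \<omega> * h' \<omega>"
      using h by (auto intro!: tendsto_intros)
    show "AE \<omega> in M. norm (D' \<omega> * h n \<omega>) \<le> C * \<bar>D' \<omega>\<bar>" for n
      using mult_right_mono[OF C, of "\<bar>D' _\<bar>"] by (intro AE_I2) (simp add: abs_mult mult.commute)
  qed (use D' in auto)
  ultimately have "(\<lambda>n. (\<integral>\<omega>. (D n \<omega> - D' \<omega>) * h n \<omega> \<partial>M) + (\<integral>\<omega>. D' \<omega> * h n \<omega> \<partial>M))
      \<longlonglongrightarrow> 0 + (\<integral>\<omega>. D' \<omega> * h' \<omega> \<partial>M)"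
    by (rule tendsto_add)
  moreover have "(\<integral>\<omega>. (D n \<omega> - D' \<omega>) * h n \<omega> \<partial>M) + (\<integral>\<omega>. D' \<omega> * h n \<omega> \<partial>M)
      = (\<integral>\<omega>. D n \<omega> * h n \<omega> \<partial>M)" for n
    using bdd[OF D, of n n] bdd[OF D', of n] by (simp add: left_diff_distrib)
  ultimately show ?thesis by simp
qed

section \<open>Directional derivatives\<close>

lemma has_dir_deriv_dir_deriv:
  assumes "\<exists>d. has_dir_deriv e f y d"
  shows "has_dir_deriv e f y (dir_deriv e f y)"
  using assms tendsto_Lim[of "at (0::real)"] by (auto simp: has_dir_deriv_def dir_deriv_def)

lemma has_dir_deriv_imp_DERIV:
  assumes "has_dir_deriv e f (y + s *\<^sub>R e) d"
  shows "((\<lambda>s. f (y + s *\<^sub>R e)) has_real_derivative d) (at s)"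
  using assms by (simp add: DERIV_def has_dir_deriv_def scaleR_left_distrib add.assoc)

text \<open>The mean value theorem for the real function \<open>s \<mapsto> f(y + s e)\<close> supplies the majorant under which
  difference quotients can be integrated to the limit.\<close>

lemma dir_deriv_bound_diff_quotient:
  fixes e :: "'a::real_normed_vector"
  assumes d: "\<And>y. has_dir_deriv e f y (d y)" and C: "\<And>y. \<bar>d y\<bar> \<le> C" and "\<epsilon> > 0"
  shows "\<bar>(f (y + \<epsilon> *\<^sub>R e) - f y) / \<epsilon>\<bar> \<le> C"
proof -
  note deriv = has_dir_deriv_imp_DERIV[OF d]
  have "\<exists>s. 0 < s \<and> s < \<epsilon> \<and>
      f (y + \<epsilon> *\<^sub>R e) - f (y + 0 *\<^sub>R e) = (\<epsilon> - 0) * d (y + s *\<^sub>R e)"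
    using \<open>\<epsilon> > 0\<close> by (intro MVT2 deriv)
  then obtain s where "f (y + \<epsilon> *\<^sub>R e) - f y = \<epsilon> * d (y + s *\<^sub>R e)"
    by auto
  then show ?thesis
    using C \<open>\<epsilon> > 0\<close> by simp
qed

section \<open>Transfer of the coupling to the terminal time\<close>

lemma bdd_measurable_measurable [measurable_dest]:
  "f \<in> bdd_measurable \<Longrightarrow> f \<in> borel_measurable borel"
  by (simp add: bdd_measurable_def)

lemma bdd_measurable_bound:
  assumes "f \<in> bdd_measurable"
  obtains C where "\<And>y. \<bar>f y\<bar> \<le> C"
  using assms by (auto simp: bdd_measurable_def bounded_iff)

text \<open>On a Banach space that is not separable, the sum of two Borel measurable functions can fail
  to be measurable. Translation by a constant is continuous, so adding a constant is
  harmless.\<close>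

lemma measurable_add_const_borel [measurable]:
  "(\<lambda>y. y + c) \<in> borel_measurable (borel :: 'a::real_normed_vector measure)"
  by (intro borel_measurable_continuous_onI continuous_intros)

lemma has_density_integral_1:
  assumes "has_density M Q R" "prob_space Q"
  shows "integrable M R" "(\<integral>\<omega>. R \<omega> \<partial>M) = 1"
proof -
  interpret Q: prob_space Q by fact
  have [measurable]: "R \<in> borel_measurable M" and R: "AE \<omega> in M. 0 \<le> R \<omega>"
    and Q: "Q = density M (\<lambda>\<omega>. ennreal (R \<omega>))"
    using assms(1) by (auto simp: has_density_def)
  have "integrable Q (\<lambda>_. 1 :: real)" by simp
  then show "integrable M R"
    unfolding Q using R by (subst (asm) integrable_density) auto
  have "(\<integral>\<omega>. 1 \<partial>Q) = (1::real)" by (simp add: Q.prob_space)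
  then show "(\<integral>\<omega>. R \<omega> \<partial>M) = 1"
    unfolding Q using R by (subst (asm) integral_density) auto
qed

text \<open>The vector \<open>e\<close> here is the total shift; the derivative formula uses the locale with
  \<open>\<epsilon> e\<close> in its place.\<close>

locale shift_coupling =
  fixes T :: real and P :: "'a::banach \<Rightarrow> (real \<Rightarrow> 'a) measure" and x e :: 'a
    and M Q :: "'w measure" and X Y :: "'w \<Rightarrow> real \<Rightarrow> 'a" and R :: "'w \<Rightarrow> real"
  assumes T: "0 \<le> T" and P: "path_kernel T P"
    and coupling: "coupling_by_change_of_measure M Q (P x) (P x) X Y"
    and density: "has_density M Q R"
    and shift: "AE \<omega> in M. Y \<omega> T = X \<omega> T + e"
begin

lemma prob_M: "prob_space M" and prob_Q: "prob_space Q" and sets_Q [measurable_cong]: "sets Q = sets M"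
  and X [measurable]: "X \<in> M \<rightarrow>\<^sub>M P x" and Y [measurable]: "Y \<in> M \<rightarrow>\<^sub>M P x"
  and distr_X: "distr M (P x) X = P x" and distr_Y: "distr Q (P x) Y = P x"
  using coupling by (auto simp: coupling_by_change_of_measure_def)

lemma R_measurable [measurable]: "R \<in> borel_measurable M" and R_nonneg: "AE \<omega> in M. 0 \<le> R \<omega>"
  and Q_eq: "Q = density M (\<lambda>\<omega>. ennreal (R \<omega>))"
  using density by (auto simp: has_density_def)

lemmas R_integrable = has_density_integral_1(1)[OF density prob_Q]
  and R_integral = has_density_integral_1(2)[OF density prob_Q]

lemma eval_measurable [measurable]: "(\<lambda>\<gamma>. \<gamma> T) \<in> P x \<rightarrow>\<^sub>M borel"
proof -
  have "P x \<in> space (prob_algebra (path_space T))"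
    using P by (auto simp: path_kernel_def intro: measurable_space)
  then have "sets (P x) = sets (path_space T)"
    by (simp add: space_prob_algebra)
  moreover have "(\<lambda>\<gamma>. \<gamma> T) \<in> path_space T \<rightarrow>\<^sub>M borel"
    using T unfolding path_space_def by (intro measurable_component_singleton) simp
  ultimately show ?thesis
    by (simp cong: measurable_cong_sets)
qed

lemma XT_measurable [measurable]: "(\<lambda>\<omega>. X \<omega> T) \<in> borel_measurable M"
  using measurable_compose[OF X eval_measurable] by simp

lemma YT_measurable [measurable]: "(\<lambda>\<omega>. Y \<omega> T) \<in> borel_measurable M"
  using measurable_compose[OF Y eval_measurable] by simp

lemma trans_prob_eq_X: "trans_prob P T x = distr M borel (\<lambda>\<omega>. X \<omega> T)"
proof -
  have "distr (distr M (P x) X) borel (\<lambda>\<gamma>. \<gamma> T) = distr M borel (\<lambda>\<omega>. X \<omega> T)"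
    by (subst distr_distr) (auto simp: comp_def)
  then show ?thesis by (simp add: trans_prob_def distr_X)
qed

text \<open>The shift relation holds almost surely under \<open>M\<close>, hence also under \<open>Q\<close>, which is
  absolutely continuous with respect to \<open>M\<close>; it is under \<open>Q\<close> that \<open>Y\<close> has law \<open>P\<^sup>x\<close>.\<close>

lemma trans_prob_eq_shift: "trans_prob P T x = distr Q borel (\<lambda>\<omega>. X \<omega> T + e)"
proof -
  have "AE \<omega> in Q. Y \<omega> T = X \<omega> T + e"
    unfolding Q_eq using shift by (subst AE_density) auto
  have "distr (distr Q (P x) Y) borel (\<lambda>\<gamma>. \<gamma> T) = distr Q borel (\<lambda>\<omega>. Y \<omega> T)"
    by (subst distr_distr) (auto simp: comp_def)
  also have "\<dots> = distr Q borel (\<lambda>\<omega>. X \<omega> T + e)"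
    by (rule distr_cong_AE) (auto intro: \<open>AE \<omega> in Q. _\<close>)
  finally show ?thesis by (simp add: trans_prob_def distr_Y)
qed

lemma markov_op_eq_X:
  assumes [measurable]: "h \<in> borel_measurable borel"
  shows "markov_op P T h x = (\<integral>\<omega>. h (X \<omega> T) \<partial>M)"
  by (simp add: markov_op_def trans_prob_eq_X integral_distr)

lemma markov_op_eq_shift:
  assumes [measurable]: "h \<in> borel_measurable borel"
  shows "markov_op P T h x = (\<integral>\<omega>. R \<omega> * h (X \<omega> T + e) \<partial>M)"
  using R_nonneg
  by (simp add: markov_op_def trans_prob_eq_shift integral_distr Q_eq integral_density)

lemma markov_op_ext_eq_shift:
  assumes [measurable]: "h \<in> borel_measurable borel"
  shows "markov_op_ext P T h x = ext_integral M (\<lambda>\<omega>. R \<omega> * h (X \<omega> T + e))"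
  using R_nonneg
  by (simp add: markov_op_ext_def trans_prob_eq_shift ext_integral_distr Q_eq ext_integral_density)

lemma integrable_bounded_X:
  fixes h :: "'a \<Rightarrow> real"
  assumes [measurable]: "h \<in> borel_measurable borel" and C: "\<And>y. \<bar>h y\<bar> \<le> C"
  shows "integrable M (\<lambda>\<omega>. h (X \<omega> T))"
proof -
  interpret prob_space M by (rule prob_M)
  show ?thesis by (rule integrable_const_bound[of _ C]) (auto simp: C)
qed

lemma integrable_R_bounded_X:
  fixes h :: "'a \<Rightarrow> real"
  assumes [measurable]: "h \<in> borel_measurable borel" and C: "\<And>y. \<bar>h y\<bar> \<le> C"
  shows "integrable M (\<lambda>\<omega>. R \<omega> * h (X \<omega> T))"
proof (rule Bochner_Integration.integrable_bound)
  show "integrable M (\<lambda>\<omega>. C * R \<omega>)" using R_integrable by simp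
  have "\<bar>h y\<bar> \<le> \<bar>C\<bar>" for y using C[of y] by linarith
  then show "AE \<omega> in M. norm (R \<omega> * h (X \<omega> T)) \<le> norm (C * R \<omega>)"
    using mult_right_mono[of "\<bar>h (X _ T)\<bar>" "\<bar>C\<bar>" "\<bar>R _\<bar>"]
    by (intro AE_I2) (simp add: abs_mult mult.commute)
qed simp

section \<open>The shift Harnack inequalities\<close>

theorem shift_Harnack:
  assumes p: "p > 1" and f: "f \<in> bdd_measurable"
  shows "ennreal (\<bar>markov_op P T f x\<bar> powr p)
    \<le> ennreal (markov_op P T (\<lambda>y. \<bar>f (e + y)\<bar> powr p) x)
        * enn_powr (\<integral>\<^sup>+\<omega>. ennreal (R \<omega> powr (p / (p - 1))) \<partial>M) (p - 1)"
proof -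
  note [measurable] = bdd_measurable_measurable[OF f]
  obtain C where C: "\<And>y. \<bar>f y\<bar> \<le> C" using bdd_measurable_bound[OF f] by blast
  have "\<bar>markov_op P T f x\<bar> \<le> (\<integral>\<omega>. \<bar>R \<omega> * f (X \<omega> T + e)\<bar> \<partial>M)"
    unfolding markov_op_eq_shift[OF \<open>f \<in> borel_measurable borel\<close>] by (rule integral_abs_bound)
  also have "\<dots> = (\<integral>\<omega>. R \<omega> * \<bar>f (X \<omega> T + e)\<bar> \<partial>M)"
    using R_nonneg by (intro integral_cong_AE) (auto simp: abs_mult)
  finally have "\<bar>markov_op P T f x\<bar> powr p \<le> (\<integral>\<omega>. R \<omega> * \<bar>f (X \<omega> T + e)\<bar> \<partial>M) powr p"
    using p by (intro powr_mono2) auto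
  then have "ennreal (\<bar>markov_op P T f x\<bar> powr p)
      \<le> ennreal ((\<integral>\<omega>. R \<omega> * \<bar>f (X \<omega> T + e)\<bar> \<partial>M) powr p)"
    by (rule ennreal_leI)
  also have "\<dots> \<le> ennreal (\<integral>\<omega>. \<bar>f (X \<omega> T + e)\<bar> powr p \<partial>M)
        * enn_powr (\<integral>\<^sup>+\<omega>. ennreal (R \<omega> powr (p / (p - 1))) \<partial>M) (p - 1)"
  proof (rule Holder_inequality_powr[OF _ _ p R_nonneg])
    show "integrable M (\<lambda>\<omega>. R \<omega> * \<bar>f (X \<omega> T + e)\<bar>)"
      using C by (intro integrable_R_bounded_X[of "\<lambda>y. \<bar>f (y + e)\<bar>" C]) auto
    show "integrable M (\<lambda>\<omega>. \<bar>f (X \<omega> T + e)\<bar> powr p)"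
      using C p by (intro integrable_bounded_X[of "\<lambda>y. \<bar>f (y + e)\<bar> powr p" "C powr p"])
        (auto intro: powr_mono2)
  qed auto
  also have "(\<integral>\<omega>. \<bar>f (X \<omega> T + e)\<bar> powr p \<partial>M) = markov_op P T (\<lambda>y. \<bar>f (e + y)\<bar> powr p) x"
    by (subst add.commute, subst markov_op_eq_X) (auto simp: add.commute[of e])
  finally show ?thesis .
qed

theorem shift_log_Harnack:
  assumes f: "f \<in> bdd_measurable" and pos: "\<And>y. f y > 0"
  shows "markov_op_ext P T (\<lambda>y. ln (f y)) x
    \<le> ereal (ln (markov_op P T (\<lambda>y. f (e + y)) x)) + ext_integral M (\<lambda>\<omega>. R \<omega> * ln (R \<omega>))"
proof -
  note [measurable] = bdd_measurable_measurable[OF f]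
  obtain C where C: "\<And>y. \<bar>f y\<bar> \<le> C" using bdd_measurable_bound[OF f] by blast
  have "markov_op_ext P T (\<lambda>y. ln (f y)) x = ext_integral M (\<lambda>\<omega>. R \<omega> * ln (f (X \<omega> T + e)))"
    by (rule markov_op_ext_eq_shift) simp
  also have "\<dots> \<le> ereal (ln (\<integral>\<omega>. f (X \<omega> T + e) \<partial>M)) + ext_integral M (\<lambda>\<omega>. R \<omega> * ln (R \<omega>))"
    using C pos by (intro entropy_inequality prob_M R_nonneg R_integrable R_integral
        integrable_bounded_X[of "\<lambda>y. f (y + e)" C]) auto
  also have "(\<integral>\<omega>. f (X \<omega> T + e) \<partial>M) = markov_op P T (\<lambda>y. f (e + y)) x"
    by (subst markov_op_eq_X) (auto simp: add.commute[of e])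
  finally show ?thesis .
qed

section \<open>Integration by parts\<close>

text \<open>The two expressions for \<open>P\<^sub>T f(x)\<close> agree, that is
  \<open>E f(X(T)) = E(f(X(T) + \<epsilon> e')) + E((R - 1) f(X(T) + \<epsilon> e'))\<close>. This moves the
  increment of \<open>f\<close> onto the density.\<close>

lemma diff_quotient_identity:
  assumes f: "f \<in> bdd_measurable" and e: "e = \<epsilon> *\<^sub>R e'"
  shows "(\<integral>\<omega>. (f (X \<omega> T + \<epsilon> *\<^sub>R e') - f (X \<omega> T)) / \<epsilon> \<partial>M)
    = - (\<integral>\<omega>. (R \<omega> - 1) / \<epsilon> * f (X \<omega> T + \<epsilon> *\<^sub>R e') \<partial>M)"
proof -
  note [measurable] = bdd_measurable_measurable[OF f]
  obtain C where C: "\<And>y. \<bar>f y\<bar> \<le> C" using bdd_measurable_bound[OF f] by blast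
  have 1: "integrable M (\<lambda>\<omega>. R \<omega> * f (X \<omega> T + e))"
    using C by (intro integrable_R_bounded_X[of "\<lambda>y. f (y + e)" C]) auto
  have 2: "integrable M (\<lambda>\<omega>. f (X \<omega> T + e))" 
    using C by (intro integrable_bounded_X[of "\<lambda>y. f (y + e)" C]) auto
  have 3: "integrable M (\<lambda>\<omega>. f (X \<omega> T))"
    using C by (intro integrable_bounded_X[of f C]) auto
  have "(\<integral>\<omega>. f (X \<omega> T + e) - f (X \<omega> T) \<partial>M) = - (\<integral>\<omega>. (R \<omega> - 1) * f (X \<omega> T + e) \<partial>M)"
    using 1 2 3 markov_op_eq_X[of f] markov_op_eq_shift[of f] by (simp add: left_diff_distrib)
  then show ?thesis by (simp add: e)
qed

end

text \<open>It suffices to pass to the limit in \<open>diff_quotient_identity\<close> along the single sequence \<open>\<epsilon>\<^sub>n = 1/(n+1)\<close>, which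
  brings in the sequential dominated convergence theorem: the difference quotients converge to the
  two-sided derivative, and the densities to the right derivative.\<close>

theorem integration_by_parts:
  fixes P :: "'a::banach \<Rightarrow> (real \<Rightarrow> 'a) measure"
  assumes T: "0 \<le> T" and P: "path_kernel T P"
    and coupling: "\<And>\<epsilon>. \<epsilon> \<in> {0<..1} \<Longrightarrow>
      coupling_by_change_of_measure M (Q \<epsilon>) (P x) (P x) X (Xe \<epsilon>)"
    and density: "\<And>\<epsilon>. \<epsilon> \<in> {0<..1} \<Longrightarrow> has_density M (Q \<epsilon>) (R \<epsilon>)"
    and shift: "\<And>\<epsilon>. \<epsilon> \<in> {0<..1} \<Longrightarrow> AE \<omega> in M. Xe \<epsilon> \<omega> T = X \<omega> T + \<epsilon> *\<^sub>R e"
    and R0: "AE \<omega> in M. R 0 \<omega> = 1"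
    and N: "has_L1_right_deriv_at_0 M R (\<lambda>\<omega>. - N \<omega>)"
    and f: "f \<in> bdd_measurable" and diff: "\<And>y. \<exists>d. has_dir_deriv e f y d"
    and df: "dir_deriv e f \<in> bdd_measurable"
  shows "markov_op P T (dir_deriv e f) x = (\<integral>\<omega>. f (X \<omega> T) * N \<omega> \<partial>M)"
proof -
  note [measurable] = bdd_measurable_measurable[OF f] bdd_measurable_measurable[OF df]
  define \<epsilon> :: "nat \<Rightarrow> real" where "\<epsilon> n = inverse (real (Suc n))" for n
  have \<epsilon>: "\<epsilon> n \<in> {0<..1}" "\<epsilon> n > 0" "\<epsilon> n \<noteq> 0" for n by (auto simp: \<epsilon>_def field_simps)
  have \<epsilon>0: "\<epsilon> \<longlonglongrightarrow> 0" unfolding \<epsilon>_def by (rule LIMSEQ_inverse_real_of_nat)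
  have right0: "filterlim \<epsilon> (at_right 0) sequentially"
    using \<epsilon> \<epsilon>0 by (auto simp: filterlim_at)
  have at0: "filterlim \<epsilon> (at 0) sequentially"
    using \<epsilon> \<epsilon>0 by (auto simp: filterlim_at)
  have sc: "shift_coupling T P x (\<epsilon> n *\<^sub>R e) M (Q (\<epsilon> n)) X (Xe (\<epsilon> n)) (R (\<epsilon> n))" for n
    using T P coupling[OF \<epsilon>(1)] density[OF \<epsilon>(1)] shift[OF \<epsilon>(1)] by unfold_locales
  interpret prob_space M by (rule shift_coupling.prob_M[OF sc])
  note [measurable] = shift_coupling.XT_measurable[OF sc] shift_coupling.R_measurable[OF sc]
  obtain C where C: "\<And>y. \<bar>f y\<bar> \<le> C" using bdd_measurable_bound[OF f] by blast
  obtain C' where C': "\<And>y. \<bar>dir_deriv e f y\<bar> \<le> C'" using bdd_measurable_bound[OF df] by blast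
  note deriv = has_dir_deriv_dir_deriv[OF diff]
  have N_int: "integrable M (\<lambda>\<omega>. - N \<omega>)"
    using N by (simp add: has_L1_right_deriv_at_0_def)
  have "(\<lambda>n. \<integral>\<omega>. (f (X \<omega> T + \<epsilon> n *\<^sub>R e) - f (X \<omega> T)) / \<epsilon> n \<partial>M)
      \<longlonglongrightarrow> (\<integral>\<omega>. dir_deriv e f (X \<omega> T) \<partial>M)"
  proof (rule integral_dominated_convergence[where w = "\<lambda>_. C'"])
    show "AE \<omega> in M. norm ((f (X \<omega> T + \<epsilon> n *\<^sub>R e) - f (X \<omega> T)) / \<epsilon> n) \<le> C'" for n
      unfolding real_norm_def by (intro AE_I2 dir_deriv_bound_diff_quotient[OF deriv C' \<epsilon>(2)])
    show "AE \<omega> in M. (\<lambda>n. (f (X \<omega> T + \<epsilon> n *\<^sub>R e) - f (X \<omega> T)) / \<epsilon> n)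
        \<longlonglongrightarrow> dir_deriv e f (X \<omega> T)"
      by (intro AE_I2 filterlim_compose[OF _ at0] deriv[unfolded has_dir_deriv_def])
  qed auto
  moreover have "(\<lambda>n. \<integral>\<omega>. (R (\<epsilon> n) \<omega> - 1) / \<epsilon> n * f (X \<omega> T + \<epsilon> n *\<^sub>R e) \<partial>M)
      \<longlonglongrightarrow> (\<integral>\<omega>. - N \<omega> * f (X \<omega> T) \<partial>M)"
  proof (rule tendsto_integral_L1_mult_bounded[where C = C])
    show "integrable M (\<lambda>\<omega>. (R (\<epsilon> n) \<omega> - 1) / \<epsilon> n)" for n
      using shift_coupling.R_integrable[OF sc[of n]] by auto
    have "(\<lambda>n. \<integral>\<^sup>+\<omega>. ennreal \<bar>(R (\<epsilon> n) \<omega> - R 0 \<omega>) / \<epsilon> n - - N \<omega>\<bar> \<partial>M) \<longlonglongrightarrow> 0"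
      using filterlim_compose[OF _ right0] N unfolding has_L1_right_deriv_at_0_def by blast
    moreover have "(\<integral>\<^sup>+\<omega>. ennreal \<bar>(R (\<epsilon> n) \<omega> - R 0 \<omega>) / \<epsilon> n - - N \<omega>\<bar> \<partial>M)
        = (\<integral>\<^sup>+\<omega>. ennreal \<bar>(R (\<epsilon> n) \<omega> - 1) / \<epsilon> n - - N \<omega>\<bar> \<partial>M)" for n
      using R0 by (intro nn_integral_cong_AE) auto
    ultimately show "(\<lambda>n. \<integral>\<^sup>+\<omega>. ennreal \<bar>(R (\<epsilon> n) \<omega> - 1) / \<epsilon> n - - N \<omega>\<bar> \<partial>M) \<longlonglongrightarrow> 0"
      by simp
    show "(\<lambda>n. f (X \<omega> T + \<epsilon> n *\<^sub>R e)) \<longlonglongrightarrow> f (X \<omega> T)" for \<omega>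
    proof -
      have "isCont (\<lambda>s. f (X \<omega> T + s *\<^sub>R e)) 0"
        by (rule DERIV_isCont, rule has_dir_deriv_imp_DERIV, rule deriv)
      from isCont_tendsto_compose[OF this \<epsilon>0] show ?thesis by simp
    qed
  qed (use N_int C in auto)
  then have "(\<lambda>n. - (\<integral>\<omega>. (R (\<epsilon> n) \<omega> - 1) / \<epsilon> n * f (X \<omega> T + \<epsilon> n *\<^sub>R e) \<partial>M))
      \<longlonglongrightarrow> - (\<integral>\<omega>. - N \<omega> * f (X \<omega> T) \<partial>M)"
    by (rule tendsto_minus)
  ultimately have "(\<integral>\<omega>. dir_deriv e f (X \<omega> T) \<partial>M) = - (\<integral>\<omega>. - N \<omega> * f (X \<omega> T) \<partial>M)"
    unfolding shift_coupling.diff_quotient_identity[OF sc f refl] by (rule LIMSEQ_unique)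
  then show ?thesis
    using shift_coupling.markov_op_eq_X[OF sc[of 0], of "dir_deriv e f"]
    by (simp add: mult.commute)
qed

theorem theorem2p1:
  fixes T :: real and x e :: "'a::banach" and P :: "'a \<Rightarrow> (real \<Rightarrow> 'a) measure"
  assumes "T > 0" and "path_kernel T P"
  shows
    "(\<forall>(M :: 'w measure) Q X Y R.
        coupling_by_change_of_measure M Q (P x) (P x) X Y \<longrightarrow>
        has_density M Q R \<longrightarrow>
        (AE \<omega> in M. Y \<omega> T = X \<omega> T + e) \<longrightarrow>
          (\<forall>p>1. \<forall>f\<in>bdd_measurable.
             ennreal (\<bar>markov_op P T f x\<bar> powr p)
               \<le> ennreal (markov_op P T (\<lambda>y. \<bar>f (e + y)\<bar> powr p) x)
                   * enn_powr (\<integral>\<^sup>+\<omega>. ennreal (R \<omega> powr (p / (p - 1))) \<partial>M) (p - 1)) \<and>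
          (\<forall>f\<in>bdd_measurable. (\<forall>y. f y > 0) \<longrightarrow>
             markov_op_ext P T (\<lambda>y. ln (f y)) x
               \<le> ereal (ln (markov_op P T (\<lambda>y. f (e + y)) x))
                   + ext_integral M (\<lambda>\<omega>. R \<omega> * ln (R \<omega>)))) \<and>
     (\<forall>(M :: 'v measure) Q X Xe R N.
        (\<forall>\<epsilon>\<in>{0..1}. coupling_by_change_of_measure M (Q \<epsilon>) (P x) (P x) X (Xe \<epsilon>)) \<longrightarrow>
        (\<forall>\<epsilon>\<in>{0..1}. has_density M (Q \<epsilon>) (R \<epsilon>)) \<longrightarrow>
        (\<forall>\<epsilon>\<in>{0<..1}. AE \<omega> in M. Xe \<epsilon> \<omega> T = X \<omega> T + \<epsilon> *\<^sub>R e) \<longrightarrow>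
        (AE \<omega> in M. R 0 \<omega> = 1) \<longrightarrow>
        has_L1_right_deriv_at_0 M R (\<lambda>\<omega>. - N \<omega>) \<longrightarrow>
          (\<forall>f. f \<in> bdd_measurable \<longrightarrow> (\<forall>y. \<exists>d. has_dir_deriv e f y d) \<longrightarrow>
             dir_deriv e f \<in> bdd_measurable \<longrightarrow>
             markov_op P T (dir_deriv e f) x = (\<integral>\<omega>. f (X \<omega> T) * N \<omega> \<partial>M)))"
proof (intro conjI allI impI ballI)
  fix M :: "'w measure" and Q X Y R
  assume "coupling_by_change_of_measure M Q (P x) (P x) X Y" "has_density M Q R"
    "AE \<omega> in M. Y \<omega> T = X \<omega> T + e"
  then interpret shift_coupling T P x e M Q X Y R
    using assms by unfold_locales auto
  show "ennreal (\<bar>markov_op P T f x\<bar> powr p)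
      \<le> ennreal (markov_op P T (\<lambda>y. \<bar>f (e + y)\<bar> powr p) x)
          * enn_powr (\<integral>\<^sup>+\<omega>. ennreal (R \<omega> powr (p / (p - 1))) \<partial>M) (p - 1)"
    if "1 < p" "f \<in> bdd_measurable" for p f
    using that by (rule shift_Harnack)
  show "markov_op_ext P T (\<lambda>y. ln (f y)) x
      \<le> ereal (ln (markov_op P T (\<lambda>y. f (e + y)) x)) + ext_integral M (\<lambda>\<omega>. R \<omega> * ln (R \<omega>))"
    if "f \<in> bdd_measurable" "\<forall>y. 0 < f y" for f
    using that by (intro shift_log_Harnack) auto
next
  fix M :: "'v measure" and Q X Xe R N f
  assume "\<forall>\<epsilon>\<in>{0..1}. coupling_by_change_of_measure M (Q \<epsilon>) (P x) (P x) X (Xe \<epsilon>)"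
    "\<forall>\<epsilon>\<in>{0..1}. has_density M (Q \<epsilon>) (R \<epsilon>)"
    "\<forall>\<epsilon>\<in>{0<..1}. AE \<omega> in M. Xe \<epsilon> \<omega> T = X \<omega> T + \<epsilon> *\<^sub>R e"
    "AE \<omega> in M. R 0 \<omega> = 1" "has_L1_right_deriv_at_0 M R (\<lambda>\<omega>. - N \<omega>)"
    "f \<in> bdd_measurable" "\<forall>y. \<exists>d. has_dir_deriv e f y d" "dir_deriv e f \<in> bdd_measurable"
  then show "markov_op P T (dir_deriv e f) x = (\<integral>\<omega>. f (X \<omega> T) * N \<omega> \<partial>M)"
    using assms by (intro integration_by_parts[where Q = Q and Xe = Xe and R = R]) auto
qed

end
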